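(* Suppose $v,w\in\widetilde S_n$ are such that $v\equiv_{\widetilde{\mathrm{syl}}}w$. Then the subtree of the affine stack-sorting tree $\widetilde{\mathscr S}_n$ with root $v$ is isomorphic as a rooted tree to the subtree of $\widetilde{\mathscr S}_n$ with root $w$. In particular, $v$ and $w$ have the same fertility, i.e. $\lvert\widetilde{\mathtt s}^{-1}(v)\rvert=\lvert\widetilde{\mathtt s}^{-1}(w)\rvert$.
   Context: An affine permutation of size $n$ is a bijection $w:\mathbb Z\to\mathbb Z$ with $w(i+n)=w(i)+n$ for all $i\in\mathbb Z$ and $\sum_{i=1}^n w(i)=\binom{n+1}{2}$. They form the affine symmetric group $\widetilde S_n$ under composition (trivial if $n=1$), a Coxeter group with simple generators $\widetilde s_1,\ldots,\widetilde s_n$, where $\widetilde s_i$ swaps $i+mn$ and $i+mn+1$ for all $m\in\mathbb Z$ and fixes all other integers. The left weak order is $x\leq_L y\iff\ell(yx^{-1})=\ell(y)-\ell(x)$, $\ell$ being Coxeter length; $e$ is the identity. Affine sylvester congruence. For $w\in\widetilde S_n$ define a partial order $\preceq_w$ on $\mathbb Z$ (positions): for $i<j$, the positions $i,j$ are incomparable if and only if there is $k$ with $i<k<j$ and $w(k)>\max\{w(i),w(j)\}$; otherwise the position with the smaller value of $w$ is below the other. (This is the descendant order of the decreasing affine binary plane tree with in-order reading $w$.) The affine sylvester congruence is $v\equiv_{\widetilde{\mathrm{syl}}}w\iff{\preceq_v}={\preceq_w}$; it is a semilattice congruence on $(\widetilde S_n,\leq_L)$ in which $\{e\}$ is a class,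 and each class has a unique $\leq_L$-minimal element. Let $\pi_\downarrow(w)$ be the minimal element of the class of $w$. The affine stack-sorting map is $\widetilde{\mathtt s}:\widetilde S_n\to\widetilde S_n$, $\widetilde{\mathtt s}(w)=w\,(\pi_\downarrow(w))^{-1}$; every element is sent to $e$ by some iterate of $\widetilde{\mathtt s}$, and $\widetilde{\mathtt s}(e)=e$. The fertility of $w$ is $\lvert\widetilde{\mathtt s}^{-1}(w)\rvert$, which is finite. The affine stack-sorting tree $\widetilde{\mathscr S}_n$ is the rooted tree with vertex set $\widetilde S_n$ and root $e$ in which the parent of each $w\neq e$ is $\widetilde{\mathtt s}(w)$. The subtree of $\widetilde{\mathscr S}_n$ with root $x$ is the rooted subtree with root $x$ and vertex set $\bigcup_{t\ge 0}\widetilde{\mathtt s}^{-t}(x)$. *)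

theory Defs
  imports Complex_Main "HOL-Number_Theory.Cong"
begin

definition affine_sym :: "nat \<Rightarrow> (int \<Rightarrow> int) set" where
  "affine_sym n = {w. bij w \<and> (\<forall>i. w (i + int n) = w i + int n) \<and>
     (\<Sum>i = 1..int n. w i) = int ((n + 1) choose 2)}"

definition simple_gen :: "nat \<Rightarrow> int \<Rightarrow> int \<Rightarrow> int" where
  "simple_gen n i = (\<lambda>j. if [j = i] (mod int n) then j + 1
     else if [j = i + 1] (mod int n) then j - 1 else j)"

text \<open>For \<open>n = 1\<close> the group is trivial and has no generators: the residues of \<open>i\<close> and
  \<open>i + 1\<close> then coincide, and \<open>simple_gen 1 i\<close> would be a translation.\<close>

definition simple_gens :: "nat \<Rightarrow> (int \<Rightarrow> int) set" where
  "simple_gens n = {simple_gen n i | i. 1 \<le> i \<and> i \<le> int n \<and> 2 \<le> n}"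

definition cox_length :: "nat \<Rightarrow> (int \<Rightarrow> int) \<Rightarrow> nat" where
  "cox_length n w =
     (LEAST k. \<exists>ss. length ss = k \<and> set ss \<subseteq> simple_gens n \<and> foldr (\<circ>) ss id = w)"

definition left_weak_le :: "nat \<Rightarrow> (int \<Rightarrow> int) \<Rightarrow> (int \<Rightarrow> int) \<Rightarrow> bool" where
  "left_weak_le n x y \<longleftrightarrow>
     int (cox_length n (y \<circ> inv x)) = int (cox_length n y) - int (cox_length n x)"

text \<open>\<open>desc_le w i j\<close> says that position \<open>i\<close> is weakly below position \<open>j\<close>. The clause on
  \<open>k\<close> is symmetric in \<open>i\<close> and \<open>j\<close>, whence \<open>min\<close> and \<open>max\<close>; it holds vacuously when
  \<open>i = j\<close>.\<close>

definition desc_le :: "(int \<Rightarrow> int) \<Rightarrow> int \<Rightarrow> int \<Rightarrow> bool" where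
  "desc_le w i j \<longleftrightarrow> w i \<le> w j \<and>
     \<not> (\<exists>k. min i j < k \<and> k < max i j \<and> w k > max (w i) (w j))"

definition affine_syl :: "nat \<Rightarrow> (int \<Rightarrow> int) \<Rightarrow> (int \<Rightarrow> int) \<Rightarrow> bool" where
  "affine_syl n v w \<longleftrightarrow>
     v \<in> affine_sym n \<and> w \<in> affine_sym n \<and> desc_le v = desc_le w"

definition pi_down :: "nat \<Rightarrow> (int \<Rightarrow> int) \<Rightarrow> (int \<Rightarrow> int)" where
  "pi_down n w = (THE u. affine_syl n u w \<and>
     (\<forall>x. affine_syl n x w \<and> left_weak_le n x u \<longrightarrow> x = u))"

text \<open>Only the restriction of \<open>stack_sort n\<close> to \<open>affine_sym n\<close> is meaningful.\<close>

definition stack_sort :: "nat \<Rightarrow> (int \<Rightarrow> int) \<Rightarrow> (int \<Rightarrow> int)" where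
  "stack_sort n w = w \<circ> inv (pi_down n w)"

definition fertility :: "nat \<Rightarrow> (int \<Rightarrow> int) \<Rightarrow> nat" where
  "fertility n w = card {u \<in> affine_sym n. stack_sort n u = w}"

record 'a rooted_tree =
  verts :: "'a set"
  edges :: "'a set set"
  root :: 'a

definition rooted_tree_iso :: "'a rooted_tree \<Rightarrow> 'b rooted_tree \<Rightarrow> bool" where
  "rooted_tree_iso S T \<longleftrightarrow> (\<exists>f. bij_betw f (verts S) (verts T) \<and> f (root S) = root T \<and>
     (\<forall>x \<in> verts S. \<forall>y \<in> verts S. {x, y} \<in> edges S \<longleftrightarrow> {f x, f y} \<in> edges T))"

definition stack_sort_tree :: "nat \<Rightarrow> (int \<Rightarrow> int) rooted_tree" where
  "stack_sort_tree n =
     \<lparr>verts = affine_sym n,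
      edges = {{w, stack_sort n w} | w. w \<in> affine_sym n \<and> w \<noteq> id},
      root = id\<rparr>"

definition stack_sort_subtree :: "nat \<Rightarrow> (int \<Rightarrow> int) \<Rightarrow> (int \<Rightarrow> int) rooted_tree" where
  "stack_sort_subtree n x =
     (let V = (\<Union>t. {u \<in> affine_sym n. (stack_sort n ^^ t) u = x})
      in \<lparr>verts = V, edges = {e \<in> edges (stack_sort_tree n). e \<subseteq> V}, root = x\<rparr>)"

end

theory Submission
  imports Defs
begin

text \<open>The isomorphism is left multiplication by \<open>g = w \<circ> inv v\<close>. The preimages of \<open>v\<close> under
  stack-sorting are the \<open>v \<circ> p\<close> where \<open>p\<close> is minimal in its sylvester class and \<open>v \<circ> p\<close> lies in
  that class. Minimal elements avoid the pattern 231, because otherwise two adjacent values could be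
  swapped downwards without changing the descendant order. If \<open>p\<close> avoids 231 and
  \<open>v \<circ> p\<close> is congruent to \<open>p\<close>, then any two positions comparable for \<open>p\<close> are sent by \<open>p\<close> to
  positions comparable for \<open>v\<close>; hence only the descendant order of \<open>v\<close> matters, and
  \<open>w \<circ> p\<close> is congruent to \<open>p\<close> as well. So \<open>g \<circ> u\<close> is congruent to \<open>u\<close>
  for each preimage \<open>u\<close> of \<open>v\<close>, and the argument repeats at every level of the tree.\<close>

section \<open>The affine symmetric group\<close>

lemma affine_symD:
  assumes "w \<in> affine_sym n"
  shows "bij w" "w (i + int n) = w i + int n"
    and "(\<Sum>i = 1..int n. w i) = int ((n + 1) choose 2)"
  using assms by (auto simp: affine_sym_def)

lemma periodic_shift:
  fixes f :: "int \<Rightarrow> int"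
  assumes "\<And>i. f (i + p) = f i + d"
  shows "f (i + m * p) = f i + m * d"
proof (induction m rule: int_induct[where k = 0])
  case (step1 m)
  have "f (i + (m + 1) * p) = f ((i + m * p) + p)"
    by (simp add: algebra_simps)
  then show ?case using step1 assms[of "i + m * p"] by (simp add: algebra_simps)
next
  case (step2 m)
  have "f ((i + (m - 1) * p) + p) = f (i + m * p)"
    by (simp add: algebra_simps)
  then show ?case using step2 assms[of "i + (m - 1) * p"] by (simp add: algebra_simps)
qed simp

lemma affine_shift:
  assumes "w \<in> affine_sym n"
  shows "w (i + m * int n) = w i + m * int n"
  using periodic_shift[of w "int n" "int n"] affine_symD(2)[OF assms] by blast

lemma affine_inv_shift:
  assumes "w \<in> affine_sym n"
  shows "inv w (i + m * int n) = inv w i + m * int n"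
  using affine_symD(1)[OF assms] affine_shift[OF assms, of "inv w i" m]
  by (metis bij_inv_eq_iff)

lemma residue_range:
  assumes "n \<ge> 1"
  shows "1 \<le> 1 + x mod int n" "1 + x mod int n \<le> int n"
proof -
  have "0 < int n" using assms by simp
  then show "1 \<le> 1 + x mod int n" "1 + x mod int n \<le> int n"
    using pos_mod_bound[of "int n" x] pos_mod_sign[of "int n" x] by linarith+
qed

text \<open>An injective map commuting with translation by \<open>n\<close> permutes the residues
  modulo \<open>n\<close>, and \<open>f\<close> depends on the residue only.\<close>

lemma sum_periodic_reindex:
  fixes f w :: "int \<Rightarrow> int"
  assumes w: "inj w" "\<And>i. w (i + int n) = w i + int n"
    and f: "\<And>i. f (i + int n) = f i"
  shows "(\<Sum>i = 1..int n. f (w i)) = (\<Sum>i = 1..int n. f i)"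
proof (cases "n = 0")
  case False
  \<comment> \<open>\<open>r x\<close> represents the residue of \<open>x\<close> in
    \<open>{1..int n}\<close>; the shift by 1 sends multiples of \<open>n\<close> to
    \<open>n\<close> rather than to 0.\<close>
  define r where "r x = 1 + (x - 1) mod int n" for x
  have r_shift: "x = r x + ((x - 1) div int n) * int n" for x
    unfolding r_def by (metis add.assoc add.commute div_mult_mod_eq diff_add_cancel)
  have r_range: "r x \<in> {1..int n}" for x
    using False residue_range[of n "x - 1"] unfolding r_def by simp
  have f_r: "f (r x) = f x" for x
    using periodic_shift[of f "int n" 0 "r x"] f r_shift[of x] by (metis add.right_neutral mult_zero_right)
  have "inj_on (\<lambda>i. r (w i)) {1..int n}"
  proof (rule inj_onI)
    fix i j assume ij: "i \<in> {1..int n}" "j \<in> {1..int n}" "r (w i) = r (w j)"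
    define m where "m = (w i - 1) div int n - (w j - 1) div int n"
    have "w i = w j + m * int n"
      using r_shift[of "w i"] r_shift[of "w j"] ij(3)
      unfolding m_def left_diff_distrib by linarith
    then have "w i = w (j + m * int n)"
      using periodic_shift[of w, OF w(2)] by simp
    then have "i = j + m * int n" using w(1) by (simp add: inj_eq)
    moreover have "\<bar>i - j\<bar> < int n" using ij by auto
    ultimately have "\<bar>m\<bar> * int n < 1 * int n" by (simp add: abs_mult)
    then have "m = 0" by (simp only: mult_less_cancel_right) auto
    then show "i = j" using \<open>i = j + m * int n\<close> by simp
  qed
  then have "bij_betw (\<lambda>i. r (w i)) {1..int n} {1..int n}"
    using endo_inj_surj[of "{1..int n}" "\<lambda>i. r (w i)"] r_range
    by (simp add: bij_betw_def image_subset_iff)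
  then have "(\<Sum>i = 1..int n. f (r (w i))) = (\<Sum>i = 1..int n. f i)"
    by (rule sum.reindex_bij_betw)
  then show ?thesis by (simp add: f_r)
qed simp

lemma sum_id_choose: "(\<Sum>i = 1..int n. i) = int ((n + 1) choose 2)"
proof (induction n)
  case (Suc n)
  have "{1..int (Suc n)} = insert (int (Suc n)) {1..int n}" by auto
  then show ?case using Suc by (simp add: numeral_2_eq_2)
qed simp

text \<open>The normalisation is put as zero total displacement because \<open>w i - i\<close> is
  periodic, so \<open>sum_periodic_reindex\<close> applies to it.\<close>

lemma affine_symI:
  assumes "bij w" "\<And>i. w (i + int n) = w i + int n" "(\<Sum>i = 1..int n. w i - i) = 0"
  shows "w \<in> affine_sym n"
  using assms by (auto simp: affine_sym_def sum_subtractf sum_id_choose)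

lemma affine_sum_displacement:
  assumes "w \<in> affine_sym n"
  shows "(\<Sum>i = 1..int n. w i - i) = 0"
  using affine_symD(3)[OF assms] by (simp add: sum_subtractf sum_id_choose)

section \<open>Closure under composition and inversion\<close>

lemma affine_id: "id \<in> affine_sym n"
  by (rule affine_symI) auto

lemma affine_comp:
  assumes v: "v \<in> affine_sym n" and w: "w \<in> affine_sym n"
  shows "v \<circ> w \<in> affine_sym n"
proof (rule affine_symI)
  show "bij (v \<circ> w)" using affine_symD(1) v w bij_comp by blast
  show "(v \<circ> w) (i + int n) = (v \<circ> w) i + int n" for i
    using affine_symD(2)[OF v] affine_symD(2)[OF w] by simp
  \<comment> \<open>The displacement of \<open>v \<circ> w\<close> at \<open>i\<close> is that of
    \<open>v\<close> at \<open>w i\<close> plus that of \<open>w\<close> at \<open>i\<close>; the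
    first part is reindexed along \<open>w\<close>.\<close>
  have "(\<Sum>i = 1..int n. v (w i) - w i) = (\<Sum>i = 1..int n. v i - i)"
    using affine_symD[OF v] affine_symD[OF w]
    by (intro sum_periodic_reindex[where f = "\<lambda>i. v i - i"]) (auto simp: bij_is_inj)
  moreover have "(\<Sum>i = 1..int n. (v \<circ> w) i - i) =
      (\<Sum>i = 1..int n. v (w i) - w i) + (\<Sum>i = 1..int n. w i - i)"
    by (simp add: sum.distrib[symmetric])
  ultimately show "(\<Sum>i = 1..int n. (v \<circ> w) i - i) = 0"
    using affine_sum_displacement v w by simp
qed

lemma affine_inv:
  assumes w: "w \<in> affine_sym n"
  shows "inv w \<in> affine_sym n"
proof (rule affine_symI)
  have b: "bij w" using w affine_symD by blast
  show "bij (inv w)" using b bij_imp_bij_inv by blast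
  show shift: "inv w (i + int n) = inv w i + int n" for i
    using affine_inv_shift[OF w, of i 1] by simp
  have "(\<Sum>i = 1..int n. inv w i - i) = (\<Sum>i = 1..int n. inv w (w i) - w i)"
    using affine_symD[OF w] b shift
    by (intro sum_periodic_reindex[where f = "\<lambda>i. inv w i - i", symmetric]) (auto simp: bij_is_inj)
  also have "\<dots> = - (\<Sum>i = 1..int n. w i - i)"
    using b by (simp add: bij_is_inj sum_negf[symmetric])
  finally show "(\<Sum>i = 1..int n. inv w i - i) = 0"
    using affine_sum_displacement[OF w] by simp
qed

text \<open>The displacement \<open>w c - c\<close> is weakly increasing and periodic, hence
  constant, and its zero sum makes it 0.\<close>

lemma affine_increasing_eq_id:
  assumes n: "n \<ge> 1" and w: "w \<in> affine_sym n" and inc: "\<And>c. w c < w (c + 1)"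
  shows "w = id"
proof -
  define g where "g c = w c - c" for c
  have step: "g c \<le> g (c + 1)" for c using inc[of c] by (simp add: g_def)
  have mono: "g c \<le> g (c + int k)" for c k
  proof (induction k)
    case (Suc k)
    then show ?case using step[of "c + int k"] by (simp add: algebra_simps)
  qed simp
  have "g (c + 1) = g c + 0" for c
  proof -
    have "g (c + 1) \<le> g (c + 1 + int (n - 1))" by (rule mono)
    also have "\<dots> = g c" using n affine_symD(2)[OF w, of c] by (simp add: g_def of_nat_diff)
    finally show ?thesis using step[of c] by simp
  qed
  then have const: "g c = g 0" for c
    using periodic_shift[of g 1 0 0 c] by simp
  have "(\<Sum>i = 1..int n. g i) = 0"
    using affine_sum_displacement[OF w] by (simp add: g_def)
  moreover have "(\<Sum>i = 1..int n. g i) = (\<Sum>i = 1..int n. g 0)"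
    by (intro sum.cong refl const)
  ultimately have "int n * g 0 = 0" by simp
  then have "g 0 = 0" using n by simp
  then show ?thesis by (metis const g_def eq_id_iff eq_iff_diff_eq_0)
qed

section \<open>Simple generators, inversions and Coxeter length\<close>

lemma cong_int_shift:
  fixes x d m :: int
  assumes "[x = d] (mod m)"
  obtains k where "x = d + k * m"
proof -
  obtain k where "x - d = m * k" using assms unfolding cong_iff_dvd_diff by (rule dvdE)
  then have "x = d + k * m" by (simp add: algebra_simps)
  then show thesis by (rule that)
qed

lemma simple_gen_cases:
  assumes "n \<ge> 2"
  obtains "[j = c] (mod int n)" "\<not> [j = c + 1] (mod int n)" "simple_gen n c j = j + 1"
  | "\<not> [j = c] (mod int n)" "[j = c + 1] (mod int n)" "simple_gen n c j = j - 1"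
  | "\<not> [j = c] (mod int n)" "\<not> [j = c + 1] (mod int n)" "simple_gen n c j = j"
proof -
  have "\<not> ([j = c] (mod int n) \<and> [j = c + 1] (mod int n))"
  proof
    assume "[j = c] (mod int n) \<and> [j = c + 1] (mod int n)"
    then have "[c = c + 1] (mod int n)" by (meson cong_sym cong_trans)
    then have "int n dvd 1" by (simp add: cong_iff_dvd_diff)
    then show False using assms by simp
  qed
  then consider "[j = c] (mod int n)" "\<not> [j = c + 1] (mod int n)"
    | "\<not> [j = c] (mod int n)" "[j = c + 1] (mod int n)"
    | "\<not> [j = c] (mod int n)" "\<not> [j = c + 1] (mod int n)" by blast
  then show thesis by cases (use that in \<open>simp_all add: simple_gen_def\<close>)
qed

lemma simple_gen_cong:
  assumes "[c = d] (mod int n)"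
  shows "simple_gen n c = simple_gen n d"
proof -
  have "[c + 1 = d + 1] (mod int n)" using assms by (simp add: cong_add)
  then show ?thesis using assms unfolding simple_gen_def cong_def by auto
qed

lemma simple_gen_in_gens:
  assumes "n \<ge> 2"
  shows "simple_gen n c \<in> simple_gens n"
proof -
  let ?d = "1 + (c - 1) mod int n"
  have "[?d = c] (mod int n)"
    by (simp add: cong_def mod_simps)
  then have "simple_gen n c = simple_gen n ?d" by (metis simple_gen_cong)
  moreover have "1 \<le> ?d" "?d \<le> int n"
    using assms residue_range[of n "c - 1"] by simp_all
  ultimately show ?thesis using assms unfolding simple_gens_def by blast
qed

lemma simple_gen_involution:
  assumes n: "n \<ge> 2"
  shows "simple_gen n c (simple_gen n c j) = j"
proof -
  have eq: "[j + 1 = c + 1] (mod int n) \<longleftrightarrow> [j = c] (mod int n)"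
    "[j - 1 = c] (mod int n) \<longleftrightarrow> [j = c + 1] (mod int n)"
    by (simp_all add: cong_iff_dvd_diff algebra_simps)
  show ?thesis
  proof (cases rule: simple_gen_cases[OF n, of j c])
    case 1
    then show ?thesis using eq by (cases rule: simple_gen_cases[OF n, of "j + 1" c]) auto
  next
    case 2
    then show ?thesis using eq by (cases rule: simple_gen_cases[OF n, of "j - 1" c]) auto
  qed simp
qed

lemma simple_gen_comp_self:
  assumes "n \<ge> 2"
  shows "simple_gen n c \<circ> (simple_gen n c \<circ> w) = w"
  using simple_gen_involution[OF assms] by (auto simp: fun_eq_iff)

lemma simple_gen_swap:
  assumes "n \<ge> 2" "[x = c] (mod int n)"
  shows "simple_gen n c x = x + 1" "simple_gen n c (x + 1) = x"
proof -
  show "simple_gen n c x = x + 1" using assms by (simp add: simple_gen_def)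
  then show "simple_gen n c (x + 1) = x" using simple_gen_involution[OF assms(1), of c x] by simp
qed

text \<open>Each integer moves by at most 1, so only pairs at distance 1 or 2 could lose their
  order.\<close>

lemma simple_gen_less:
  assumes n: "n \<ge> 2" and "x < y" and not: "\<not> ([x = c] (mod int n) \<and> y = x + 1)"
  shows "simple_gen n c x < simple_gen n c y"
proof -
  have succ: "[y = c + 1] (mod int n) \<longleftrightarrow> [x = c] (mod int n)" if "y = x + 1"
    using that by (simp add: cong_iff_dvd_diff)
  \<comment> \<open>At distance 2 the values would meet if \<open>x\<close> moved up and
    \<open>y\<close> down, but then \<open>n\<close> would divide 1.\<close>
  have two: "simple_gen n c x < simple_gen n c y" if "y = x + 2" "[x = c] (mod int n)"
    "[y = c + 1] (mod int n)"
  proof -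
    have "int n dvd (y - (c + 1)) - (x - c)"
      using that(2,3) unfolding cong_iff_dvd_diff by (simp only: dvd_diff)
    then show ?thesis using n that(1) by simp
  qed
  show ?thesis
    using \<open>x < y\<close> not succ two
    by (cases rule: simple_gen_cases[OF n, of x c]; cases rule: simple_gen_cases[OF n, of y c];
        cases "y = x + 1"; cases "y = x + 2") auto
qed

lemma simple_gen_affine:
  assumes n: "n \<ge> 2"
  shows "simple_gen n c \<in> affine_sym n"
proof -
  \<comment> \<open>For index 1 the swapped pair 1, 2 lies inside the summation window, so its
    displacements cancel; for index \<open>n\<close> the pair straddles the end.\<close>
  let ?s = "simple_gen n 1"
  have shift: "simple_gen n a (i + int n) = simple_gen n a i + int n" for a i
    by (simp add: simple_gen_def cong_def)
  have bij: "bij (simple_gen n a)" for a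
    using simple_gen_involution[OF n] by (intro o_bij[where g = "simple_gen n a"]) auto
  have "?s \<in> affine_sym n"
  proof (rule affine_symI[OF bij shift])
    have "?s i = i" if "i \<in> {1..int n}" "i \<notin> {1, 2}" for i
    proof -
      have "i mod int n = (if i = int n then 0 else i)" using that by auto
      then show ?thesis using that n
        by (cases "n = 2") (auto simp: simple_gen_def cong_def)
    qed
    then have "(\<Sum>i = 1..int n. ?s i - i) = (\<Sum>i \<in> {1, 2}. ?s i - i)"
      using n by (intro sum.mono_neutral_right) auto
    also have "\<dots> = 0"
      using simple_gen_swap[OF n, of 1 1] by simp
    finally show "(\<Sum>i = 1..int n. ?s i - i) = 0" .
  qed
  text \<open>All generators have the same total displacement, being conjugate under translations.\<close>
  have conj: "simple_gen n c i - i = ?s (i - (c - 1)) - (i - (c - 1))" for i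
    by (simp add: simple_gen_def cong_iff_dvd_diff algebra_simps)
  have "(\<Sum>i = 1..int n. ?s (i - (c - 1)) - (i - (c - 1))) = (\<Sum>i = 1..int n. ?s i - i)"
    using shift
    by (intro sum_periodic_reindex[where f = "\<lambda>i. ?s i - i" and w = "\<lambda>i. i - (c - 1)"])
      (auto simp: inj_def add_diff_eq[symmetric] diff_add_eq)
  then have "(\<Sum>i = 1..int n. simple_gen n c i - i) = 0"
    using affine_sum_displacement[OF \<open>?s \<in> affine_sym n\<close>] by (simp only: conj)
  then show ?thesis by (rule affine_symI[OF bij shift])
qed

section \<open>Inversions and the effect of a simple generator on them\<close>

definition inversions :: "nat \<Rightarrow> (int \<Rightarrow> int) \<Rightarrow> (int \<times> int) set" where
  "inversions n w = {(i, j). 1 \<le> i \<and> i \<le> int n \<and> i < j \<and> w j < w i}"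

text \<open>Fixing the first position in \<open>{1..int n}\<close> keeps one inversion per
  translation class. Displacements are bounded by periodicity, and an inversion spans less than
  twice the bound \<open>B\<close>.\<close>

lemma finite_inversions:
  assumes n: "n \<ge> 1" and w: "w \<in> affine_sym n"
  shows "finite (inversions n w)"
proof -
  define B where "B = Max ((\<lambda>i. \<bar>w i - i\<bar>) ` {1..int n})"
  have B1: "\<bar>w i - i\<bar> \<le> B" if "i \<in> {1..int n}" for i
    unfolding B_def using that by (intro Max_ge) auto
  have B: "\<bar>w x - x\<bar> \<le> B" for x
  proof -
    define r where "r = 1 + (x - 1) mod int n"
    have "x = r + ((x - 1) div int n) * int n"
      unfolding r_def by (metis add.assoc add.commute div_mult_mod_eq diff_add_cancel)
    then have "w x - x = w r - r" using affine_shift[OF w, of r] by (metis add_diff_cancel_right)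
    moreover have "r \<in> {1..int n}"
      using n residue_range[of n "x - 1"] unfolding r_def by simp
    ultimately show ?thesis using B1 by simp
  qed
  have "inversions n w \<subseteq> {1..int n} \<times> {1..int n + 2 * B}"
  proof
    fix z assume "z \<in> inversions n w"
    then obtain i j where "z = (i, j)" "1 \<le> i" "i \<le> int n" "i < j" "w j < w i"
      by (auto simp: inversions_def)
    then show "z \<in> {1..int n} \<times> {1..int n + 2 * B}" using B[of i] B[of j] by auto
  qed
  then show ?thesis by (rule finite_subset) auto
qed

text \<open>The generator exchanges the values \<open>c + k * int n\<close> and
  \<open>c + 1 + k * int n\<close> and keeps all other comparisons. These pairs form one translation
  class, inverted in \<open>w\<close> by \<open>desc\<close>, so exactly one counted inversion is
  lost.\<close>

lemma card_inversions_descent: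
  assumes n: "n \<ge> 2" and w: "w \<in> affine_sym n" and desc: "inv w (c + 1) < inv w c"
  shows "card (inversions n w) = Suc (card (inversions n (simple_gen n c \<circ> w)))"
proof -
  have b: "bij w" using w affine_symD by blast
  \<comment> \<open>\<open>m\<close> translates the position of \<open>c + 1\<close> into
    \<open>{1..int n}\<close>; \<open>d\<close> is the value \<open>c\<close> translated
    alike.\<close>
  define m where "m = - ((inv w (c + 1) - 1) div int n)"
  define d where "d = c + m * int n"
  define i0 where "i0 = inv w (d + 1)"
  define j0 where "j0 = inv w d"
  define s where "s = simple_gen n d"
  have s: "simple_gen n c = s"
    unfolding s_def by (rule simple_gen_cong) (simp add: d_def cong_iff_dvd_diff)
  have i0: "i0 = inv w (c + 1) + m * int n"
    using affine_inv_shift[OF w, of "c + 1" m] by (simp add: i0_def d_def algebra_simps)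
  have j0: "j0 = inv w c + m * int n"
    using affine_inv_shift[OF w, of c m] by (simp add: j0_def d_def)
  have less: "i0 < j0" using desc i0 j0 by simp
  have "i0 = 1 + (inv w (c + 1) - 1) mod int n"
    using div_mult_mod_eq[of "inv w (c + 1) - 1" "int n"] 
    unfolding i0 m_def mult_minus_left by linarith
  then have i0_range: "1 \<le> i0" "i0 \<le> int n"
    using n residue_range[of n "inv w (c + 1) - 1"] by simp_all
  have w0: "w i0 = d + 1" "w j0 = d"
    unfolding i0_def j0_def using b by (simp_all add: bij_is_surj surj_f_inv_f)
  have pos: "i = i0 + k * int n \<and> j = j0 + k * int n"
    if "w i = d + k * int n + 1" "w j = d + k * int n" for i j k
  proof
    have "w i = w (i0 + k * int n)" "w j = w (j0 + k * int n)"
      using that w0 affine_shift[OF w] by auto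
    then show "i = i0 + k * int n" "j = j0 + k * int n" using b by (simp_all add: bij_is_inj inj_eq)
  qed
  have "inversions n w = insert (i0, j0) (inversions n (s \<circ> w))"
  proof (intro equalityI subsetI)
    fix z assume "z \<in> inversions n w"
    then obtain i j where z: "z = (i, j)" "1 \<le> i" "i \<le> int n" "i < j" "w j < w i"
      by (auto simp: inversions_def)
    show "z \<in> insert (i0, j0) (inversions n (s \<circ> w))"
    proof (cases "[w j = d] (mod int n) \<and> w i = w j + 1")
      case True
      then obtain k where k: "w j = d + k * int n" using cong_int_shift by blast
      then have ij: "i = i0 + k * int n" "j = j0 + k * int n" using True pos[of i k j] by auto
      then have "\<bar>k * int n\<bar> < int n" using z(2,3) i0_range by auto
      then have "\<bar>k\<bar> * int n < 1 * int n" by (simp add: abs_mult)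
      then have "k = 0" by (simp only: mult_less_cancel_right) auto
      then show ?thesis using ij z by simp
    next
      case False
      then have "s (w j) < s (w i)" unfolding s_def using simple_gen_less[OF n z(5)] by blast
      then show ?thesis using z by (auto simp: inversions_def)
    qed
  next
    fix z assume "z \<in> insert (i0, j0) (inversions n (s \<circ> w))"
    then consider "z = (i0, j0)" | "z \<in> inversions n (s \<circ> w)" by blast
    then show "z \<in> inversions n w"
    proof cases
      case 1
      then show ?thesis using i0_range less w0 by (simp add: inversions_def)
    next
      case 2
      then obtain i j where z: "z = (i, j)" "1 \<le> i" "i \<le> int n" "i < j" "s (w j) < s (w i)"
        by (auto simp: inversions_def)
      have invol: "s (s x) = x" for x unfolding s_def by (rule simple_gen_involution[OF n])
      show ?thesis
      proof (cases "[s (w j) = d] (mod int n) \<and> s (w i) = s (w j) + 1")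
        case True
        then obtain k where k: "s (w j) = d + k * int n" using cong_int_shift by blast
        \<comment> \<open>Here \<open>w i\<close> is the smaller value of the swapped pair, so
          \<open>j\<close> and \<open>i\<close> are translates of \<open>i0\<close> and
          \<open>j0\<close>, contradicting \<open>i < j\<close>.\<close>
        have "w j = s (w j) + 1" "w i = s (w j)"
          using simple_gen_swap[OF n, of "s (w j)" d] True invol[of "w j"] invol[of "w i"]
          by (auto simp: s_def)
        then have "j = i0 + k * int n" "i = j0 + k * int n" using k pos[of j k i] by auto
        then show ?thesis using z(4) less by simp
      next
        case False
        then have "s (s (w j)) < s (s (w i))"
          using simple_gen_less[OF n z(5)] unfolding s_def by blast
        then show ?thesis using z by (auto simp: invol inversions_def)
      qed
    qed
  qed
  moreover have "(i0, j0) \<notin> inversions n (s \<circ> w)"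
    using simple_gen_swap[OF n, of d d] w0 by (auto simp: inversions_def s_def)
  moreover have "finite (inversions n (s \<circ> w))"
    using n w s simple_gen_affine[OF n, of c] by (intro finite_inversions affine_comp) auto
  ultimately show ?thesis unfolding s by simp
qed

text \<open>Either \<open>inv w\<close> has a descent at \<open>c\<close> and the count falls, or
  the product has one there and the exact formula applies to it, since multiplying twice gives back
  \<open>w\<close>.\<close>

lemma card_inversions_simple_gen_le:
  assumes n: "n \<ge> 2" and w: "w \<in> affine_sym n"
  shows "card (inversions n (simple_gen n c \<circ> w)) \<le> Suc (card (inversions n w))"
proof -
  let ?s = "simple_gen n c"
  have b: "bij w" using w affine_symD by blast
  have sw: "?s \<circ> w \<in> affine_sym n" using simple_gen_affine[OF n] w affine_comp by blast
  have "inv w c \<noteq> inv w (c + 1)"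
    using b by (metis add_cancel_left_right bij_inv_eq_iff zero_neq_one)
  moreover have "inv (?s \<circ> w) (c + 1) = inv w c" "inv (?s \<circ> w) c = inv w (c + 1)"
    using affine_symD(1)[OF sw] b simple_gen_swap[OF n, of c c]
    by (simp_all add: inv_f_eq bij_is_inj bij_is_surj surj_f_inv_f)
  ultimately consider "inv w (c + 1) < inv w c" | "inv (?s \<circ> w) (c + 1) < inv (?s \<circ> w) c"
    by linarith
  then show ?thesis
  proof cases
    case 1
    then show ?thesis using card_inversions_descent[OF n w] by simp
  next
    case 2
    then show ?thesis
      using card_inversions_descent[OF n sw 2] simple_gen_comp_self[OF n, of c w] by simp
  qed
qed

section \<open>Words in the generators and Coxeter length\<close>

lemma foldr_simple_gens:
  assumes "set ss \<subseteq> simple_gens n"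
  shows "foldr (\<circ>) ss id \<in> affine_sym n \<and> card (inversions n (foldr (\<circ>) ss id)) \<le> length ss"
  using assms
proof (induction ss)
  case Nil
  have "inversions n id = {}" by (auto simp: inversions_def)
  then show ?case using affine_id by (simp add: id_def)
next
  case (Cons s ss)
  then obtain c where c: "s = simple_gen n c" "n \<ge> 2" by (auto simp: simple_gens_def)
  let ?w = "foldr (\<circ>) ss id"
  have w: "?w \<in> affine_sym n" "card (inversions n ?w) \<le> length ss"
    using Cons.IH Cons.prems by (simp_all only: list.set insert_subset)
  have "s \<circ> ?w \<in> affine_sym n"
    unfolding c(1) by (rule affine_comp[OF simple_gen_affine[OF c(2)] w(1)])
  moreover have "card (inversions n (s \<circ> ?w)) \<le> Suc (card (inversions n ?w))"
    unfolding c(1) by (rule card_inversions_simple_gen_le[OF c(2) w(1)])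
  moreover have "foldr (\<circ>) (s # ss) id = s \<circ> ?w" by simp
  ultimately show ?case using w(2) by (metis Suc_le_mono le_trans length_Cons)
qed

text \<open>If \<open>inv w\<close> has no descent, it is increasing and hence the identity;
  otherwise the generator at a descent lowers the inversion count by one.\<close>

lemma reduced_word_exists:
  assumes n: "n \<ge> 1" and "w \<in> affine_sym n"
  shows "\<exists>ss. length ss = card (inversions n w) \<and> set ss \<subseteq> simple_gens n \<and> foldr (\<circ>) ss id = w"
  using assms(2)
proof (induction "card (inversions n w)" arbitrary: w rule: less_induct)
  case less
  have b: "bij w" using less.prems affine_symD by blast
  show ?case
  proof (cases "w = id")
    case True
    moreover have "inversions n id = {}" by (auto simp: inversions_def)
    ultimately show ?thesis by (intro exI[of _ "[]"]) simp
  next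
    case False
    then have "inv w \<noteq> id" using b by (metis inv_id inv_inv_eq)
    then obtain c where "\<not> inv w c < inv w (c + 1)"
      using affine_increasing_eq_id[OF n affine_inv[OF less.prems]] by blast
    moreover have "inv w c \<noteq> inv w (c + 1)"
      using b by (metis add_cancel_left_right bij_inv_eq_iff zero_neq_one)
    ultimately have desc: "inv w (c + 1) < inv w c" by simp
    have n2: "n \<ge> 2"
    proof (rule ccontr)
      assume "\<not> n \<ge> 2"
      then have "n = 1" using n by simp
      then show False using affine_inv_shift[OF less.prems, of c 1] desc by simp
    qed
    let ?u = "simple_gen n c \<circ> w"
    have card: "card (inversions n w) = Suc (card (inversions n ?u))"
      by (rule card_inversions_descent[OF n2 less.prems desc])
    have "?u \<in> affine_sym n" using affine_comp[OF simple_gen_affine[OF n2]] less.prems by blast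
    then obtain ss where ss: "length ss = card (inversions n ?u)" "set ss \<subseteq> simple_gens n"
      "foldr (\<circ>) ss id = ?u"
      using less.hyps[of ?u] card by auto
    then show ?thesis
      using card simple_gen_in_gens[OF n2] simple_gen_comp_self[OF n2]
      by (intro exI[of _ "simple_gen n c # ss"]) simp
  qed
qed

text \<open>Each letter of a word adds at most one inversion, so no word is shorter than the count;
  removing descents attains it.\<close>

lemma cox_length_eq_card_inversions:
  assumes "n \<ge> 1" and "w \<in> affine_sym n"
  shows "cox_length n w = card (inversions n w)"
  unfolding cox_length_def
proof (rule Least_equality)
  show "\<exists>ss. length ss = card (inversions n w) \<and> set ss \<subseteq> simple_gens n \<and> foldr (\<circ>) ss id = w"
    by (rule reduced_word_exists[OF assms])
  fix k
  assume "\<exists>ss. length ss = k \<and> set ss \<subseteq> simple_gens n \<and> foldr (\<circ>) ss id = w"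
  then show "card (inversions n w) \<le> k" using foldr_simple_gens by blast
qed

lemma cox_length_eq_0_imp_id:
  assumes "n \<ge> 1" and "w \<in> affine_sym n" and "cox_length n w = 0"
  shows "w = id"
  using reduced_word_exists[OF assms(1,2)] assms(3) cox_length_eq_card_inversions[OF assms(1,2)]
  by auto

lemma cox_length_simple_gen:
  assumes n: "n \<ge> 2"
  shows "cox_length n (simple_gen n c) = 1"
proof -
  have "cox_length n (simple_gen n c) \<le> Suc (card (inversions n id))"
    using card_inversions_simple_gen_le[OF n affine_id, of c] n
    by (simp add: cox_length_eq_card_inversions simple_gen_affine)
  also have "inversions n id = {}" by (auto simp: inversions_def)
  finally have "cox_length n (simple_gen n c) \<le> 1" by simp
  moreover have "simple_gen n c \<noteq> id"
    using simple_gen_swap(1)[OF n, of c c] by auto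
  then have "cox_length n (simple_gen n c) \<noteq> 0"
    using n cox_length_eq_0_imp_id[of n "simple_gen n c"] simple_gen_affine by auto
  ultimately show ?thesis by simp
qed

section \<open>Descendant orders\<close>

text \<open>It is enough that \<open>q\<close> respects the relations of \<open>p\<close>, because
  an incomparability in \<open>p\<close> is itself witnessed by relations: the highest position in
  between is above both ends.\<close>

lemma desc_le_eqI:
  assumes q: "inj q" and le: "\<And>i j. desc_le p i j \<Longrightarrow> q i \<le> q j"
  shows "desc_le p = desc_le q"
proof (intro ext iffI)
  fix i j assume ij: "desc_le p i j"
  \<comment> \<open>Positions between \<open>i\<close> and \<open>j\<close> have
    \<open>p\<close>-values at most \<open>p j\<close>, hence lie below \<open>j\<close> for
    \<open>p\<close>, so none of them blocks the relation for \<open>q\<close>.\<close>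
  have "q k \<le> q j" if "min i j < k" "k < max i j" for k
  proof (rule le)
    have *: "p m \<le> p j" if "min i j < m" "m < max i j" for m
      using that ij unfolding desc_le_def by force
    then show "desc_le p k j" using that unfolding desc_le_def
      by (smt (verit, best))
  qed
  then show "desc_le q i j" using le[OF ij] unfolding desc_le_def by fastforce
next
  fix i j assume ij: "desc_le q i j"
  have nok: "\<not> (\<exists>k. min i j < k \<and> k < max i j \<and> p k > max (p i) (p j))"
  proof
    assume "\<exists>k. min i j < k \<and> k < max i j \<and> p k > max (p i) (p j)"
    then obtain k0 where k0: "k0 \<in> {min i j<..<max i j}" "p k0 > max (p i) (p j)" by auto
    let ?I = "{min i j<..<max i j}"
    have "Max (p ` ?I) \<in> p ` ?I" using k0(1) by (intro Max_in) auto
    then obtain k where k: "k \<in> ?I" and "p k = Max (p ` ?I)" by (metis image_iff)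
    then have k_max: "p m \<le> p k" if "m \<in> ?I" for m
      using that by (simp add: Max_ge)
    have big: "p k > max (p i) (p j)" using k_max[OF k0(1)] k0(2) by simp
    have between: "m \<in> ?I" if "min a k < m" "m < max a k" "a \<in> {i, j}" for a m
      using that k by (auto simp: min_def max_def split: if_splits)
    have "desc_le p a k" if "a \<in> {i, j}" for a
    proof -
      have "\<not> p m > max (p a) (p k)" if "min a k < m" "m < max a k" for m
        using k_max[OF between[OF that \<open>a \<in> {i, j}\<close>]] by simp
      then show ?thesis using big \<open>a \<in> {i, j}\<close> unfolding desc_le_def by auto
    qed
    then have "desc_le p i k" "desc_le p j k" by simp_all
    then have "q i \<le> q k" "q j \<le> q k" using le by auto
    moreover have "q i \<noteq> q k" "q j \<noteq> q k" using q k by (auto simp: inj_eq)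
    ultimately have "q k > max (q i) (q j)" by simp
    moreover have "min i j < k" "k < max i j" using k by auto
    ultimately show False using ij unfolding desc_le_def by blast
  qed
  show "desc_le p i j"
  proof (cases "p i \<le> p j")
    case True
    then show ?thesis using nok unfolding desc_le_def by blast
  next
    case False
    then have "desc_le p j i" using nok unfolding desc_le_def
      by (metis linorder_le_cases max.commute min.commute)
    then have "q i = q j" using le ij by (force simp: desc_le_def)
    then show ?thesis using q False by (simp add: inj_eq)
  qed
qed

definition avoids_231 :: "(int \<Rightarrow> int) \<Rightarrow> bool" where
  "avoids_231 p \<longleftrightarrow> \<not> (\<exists>i k j. i < k \<and> k < j \<and> p j < p i \<and> p i < p k)"

text \<open>\<open>p\<close> carries its own relations to relations of \<open>v\<close>, hence of
  \<open>w\<close>, which is what \<open>desc_le_eqI\<close> asks of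
  \<open>w \<circ> p\<close>.\<close>

lemma desc_le_comp_eq:
  assumes p: "bij p" and w: "inj w" and av: "avoids_231 p"
    and vp: "desc_le (v \<circ> p) = desc_le p" and vw: "desc_le v = desc_le w"
  shows "desc_le (w \<circ> p) = desc_le p"
proof (rule desc_le_eqI[symmetric])
  show "inj (w \<circ> p)" using w p by (simp add: bij_is_inj inj_compose)
  fix i j assume ij: "desc_le p i j"
  have "desc_le (v \<circ> p) i j" using ij vp by simp
  then have lt: "v (p i) \<le> v (p j)" by (simp add: desc_le_def)
  have "desc_le v (p i) (p j)"
  proof (rule ccontr)
    assume "\<not> desc_le v (p i) (p j)"
    then obtain c where c: "p i < c" "c < p j" "v c > v (p j)"
      using lt ij unfolding desc_le_def by (auto simp: min_def max_def split: if_splits)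
    obtain k where k: "c = p k" using p by (metis bij_pointE)
    have "\<not> desc_le (v \<circ> p) k j" using c(3) k by (simp add: desc_le_def)
    then have "\<not> desc_le p k j" using vp by simp
    \<comment> \<open>As \<open>p k < p j\<close>, the positions \<open>k\<close> and
      \<open>j\<close> can only be incomparable for \<open>p\<close>, so a higher position
      \<open>m\<close> separates them.\<close>
    then obtain m where m: "min k j < m" "m < max k j" "p m > p j"
      using c k unfolding desc_le_def by (auto simp: max_def)
    have "\<not> (min i j < m \<and> m < max i j)" using ij m(3) c unfolding desc_le_def by auto
    moreover have "m \<noteq> i" "k \<noteq> i" "k \<noteq> j" using c k m by auto
    \<comment> \<open>In the first case \<open>j\<close>, \<open>m\<close>, \<open>k\<close> form a
      231 pattern, in the second \<open>k\<close>, \<open>m\<close>, \<open>i\<close>.\<close>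
    ultimately have "(j < m \<and> m < k) \<or> (k < m \<and> m < i)"
      using m(1,2) by (auto simp: min_def max_def split: if_splits)
    then show False using av c k m(3) unfolding avoids_231_def by (smt (verit))
  qed
  then have "desc_le w (p i) (p j)" using vw by simp
  then show "(w \<circ> p) i \<le> (w \<circ> p) j" by (simp add: desc_le_def)
qed

section \<open>The minimal element of a sylvester class\<close>

text \<open>Adjacent positions are always comparable, so agreement with the order of
  \<open>id\<close> makes \<open>w\<close> increasing.\<close>

lemma affine_syl_id:
  assumes "n \<ge> 1" and "affine_syl n w id"
  shows "w = id"
proof (rule affine_increasing_eq_id[OF assms(1)])
  show "w \<in> affine_sym n" using assms(2) by (simp add: affine_syl_def)
  fix c
  have "desc_le id c (c + 1)" by (auto simp: desc_le_def)
  then have "desc_le w c (c + 1)" using assms(2) by (simp add: affine_syl_def)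
  then have "w c \<le> w (c + 1)" by (simp add: desc_le_def)
  moreover have "w c \<noteq> w (c + 1)"
    using affine_symD(1)[OF \<open>w \<in> affine_sym n\<close>] by (simp add: bij_is_inj inj_eq)
  ultimately show "w c < w (c + 1)" by simp
qed

text \<open>A 231 pattern \<open>i\<close>, \<open>k\<close>, \<open>j\<close> yields values
  \<open>c + 1\<close> left of \<open>k\<close> and \<open>c\<close> right of it, both below
  \<open>u k\<close>. Translates of \<open>k\<close> make all swapped pairs incomparable, so the
  swap keeps the descendant order while it shortens \<open>u\<close>.\<close>

lemma minimal_imp_avoids_231:
  assumes n: "n \<ge> 1" and u: "u \<in> affine_sym n"
    and minimal: "\<And>x. affine_syl n x u \<Longrightarrow> left_weak_le n x u \<Longrightarrow> x = u"
  shows "avoids_231 u"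
proof (rule ccontr)
  assume "\<not> avoids_231 u"
  then obtain i k j where ikj: "i < k" "k < j" "u j < u i" "u i < u k"
    by (auto simp: avoids_231_def)
  have b: "bij u" using u affine_symD by blast
  have inv_u: "inv u (u x) = x" "u (inv u x) = x" for x
    using b by (simp_all add: bij_is_inj bij_is_surj surj_f_inv_f)
  \<comment> \<open>A discrete intermediate value argument: \<open>u j\<close> occurs to the right
    of \<open>k\<close> and \<open>u i\<close> to the left, so the side changes between two
    consecutive values.\<close>
  have "\<exists>c. inv u (c + 1) < k \<and> k < inv u c \<and> c + 1 < u k"
  proof (rule ccontr)
    assume none: "\<not> ?thesis"
    have "u j + int m \<le> u i \<longrightarrow> k < inv u (u j + int m)" for m
    proof (induction m)
      case 0
      then show ?case using ikj inv_u by simp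
    next
      case (Suc m)
      show ?case
      proof
        assume *: "u j + int (Suc m) \<le> u i"
        then have "k < inv u (u j + int m)" using Suc by simp
        moreover have "u j + int m + 1 < u k" using * ikj by simp
        ultimately have "\<not> inv u (u j + int m + 1) < k" using none by blast
        moreover have "inv u (u j + int m + 1) \<noteq> k"
          using \<open>u j + int m + 1 < u k\<close> inv_u(2)[of "u j + int m + 1"] by auto
        ultimately show "k < inv u (u j + int (Suc m))" by (simp add: algebra_simps)
      qed
    qed
    from this[of "nat (u i - u j)"] show False using ikj inv_u by simp
  qed
  then obtain c where c: "inv u (c + 1) < k" "k < inv u c" "c + 1 < u k" by blast
  have n2: "n \<ge> 2"
  proof (rule ccontr)
    assume "\<not> n \<ge> 2"
    then have "n = 1" using n by simp
    then show False using affine_inv_shift[OF u, of c 1] c by simp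
  qed
  let ?s = "simple_gen n c"
  have su: "?s \<circ> u \<in> affine_sym n" using affine_comp[OF simple_gen_affine[OF n2] u] .
  have "desc_le u = desc_le (?s \<circ> u)"
  proof (rule desc_le_eqI)
    show "inj (?s \<circ> u)" using affine_symD(1)[OF su] by (simp add: bij_is_inj)
    fix a e assume ae: "desc_le u a e"
    show "(?s \<circ> u) a \<le> (?s \<circ> u) e"
    proof (cases "a = e")
      case False
      then have "u a < u e" using ae b
        by (metis desc_le_def bij_is_inj inj_eq order_le_less)
      moreover have "\<not> ([u a = c] (mod int n) \<and> u e = u a + 1)"
      proof
        assume *: "[u a = c] (mod int n) \<and> u e = u a + 1"
        then obtain m where m: "u a = c + m * int n"
          using cong_int_shift by blast
        have "a = inv u c + m * int n" "e = inv u (c + 1) + m * int n"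
          using affine_inv_shift[OF u, of c m] affine_inv_shift[OF u, of "c + 1" m] * m
            inv_u(1)[of a] inv_u(1)[of e] by (simp_all add: algebra_simps)
        then have "min a e < k + m * int n" "k + m * int n < max a e" using c by auto
        moreover have "u (k + m * int n) > max (u a) (u e)"
          using affine_shift[OF u] c(3) * m by simp
        ultimately show False using ae unfolding desc_le_def by blast
      qed
      ultimately have "?s (u a) < ?s (u e)" by (rule simple_gen_less[OF n2])
      then show ?thesis by simp
    qed simp
  qed
  then have syl: "affine_syl n (?s \<circ> u) u" using u su by (simp add: affine_syl_def)
  have "cox_length n u = Suc (cox_length n (?s \<circ> u))"
    using card_inversions_descent[OF n2 u, of c] c
    by (simp add: cox_length_eq_card_inversions[OF n u] cox_length_eq_card_inversions[OF n su])
  \<comment> \<open>The quotient of \<open>u\<close> by the shorter element is a single generator,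
    whose length 1 matches the loss of one inversion.\<close>
  moreover have "u \<circ> inv (?s \<circ> u) = ?s"
  proof
    fix x
    have "x = (?s \<circ> u) (inv u (?s x))" using inv_u simple_gen_involution[OF n2] by simp
    then have "inv (?s \<circ> u) x = inv u (?s x)"
      using affine_symD(1)[OF su] by (metis bij_inv_eq_iff)
    then show "(u \<circ> inv (?s \<circ> u)) x = ?s x" using inv_u by simp
  qed
  ultimately have "left_weak_le n (?s \<circ> u) u"
    by (simp add: left_weak_le_def cox_length_simple_gen[OF n2])
  then have "?s \<circ> u = u" using minimal syl by blast
  then have "?s (u (inv u c)) = u (inv u c)" by (metis comp_apply)
  then show False using simple_gen_swap(1)[OF n2, of c c] inv_u by simp
qed

text \<open>For 231-avoiding elements the descendant order decides every comparison of values, so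
  \<open>u \<circ> inv x\<close> is increasing.\<close>

lemma avoids_231_unique:
  assumes n: "n \<ge> 1" and syl: "affine_syl n u x" and av: "avoids_231 u" "avoids_231 x"
  shows "u = x"
proof -
  have ux: "u \<in> affine_sym n" "x \<in> affine_sym n" "desc_le u = desc_le x"
    using syl by (auto simp: affine_syl_def)
  text \<open>In a 231-avoiding element incomparable positions carry increasing values.\<close>
  have ord: "p i < p j \<longleftrightarrow> (if i < j then \<not> desc_le p j i else i \<noteq> j \<and> desc_le p i j)"
    if "inj p" "avoids_231 p" for p i j
  proof -
    have "i = j \<longleftrightarrow> p i = p j" using that by (simp add: inj_eq)
    then show ?thesis using that(2) unfolding desc_le_def avoids_231_def
      by (smt (verit))
  qed
  have order: "u i < u j \<longleftrightarrow> x i < x j" for i j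
    using ord[OF _ av(1), of i j] ord[OF _ av(2), of i j] ux affine_symD(1) bij_is_inj by metis
  have b: "bij x" using ux affine_symD by blast
  have "u \<circ> inv x = id"
  proof (rule affine_increasing_eq_id[OF n affine_comp[OF ux(1) affine_inv[OF ux(2)]]])
    fix c show "(u \<circ> inv x) c < (u \<circ> inv x) (c + 1)"
      using b by (simp add: order bij_is_surj surj_f_inv_f)
  qed
  then have "(u \<circ> inv x) (x i) = x i" for i by simp
  then show ?thesis using b by (auto simp: fun_eq_iff bij_is_inj)
qed

text \<open>This justifies the definite description in \<open>pi_down\<close>: a shortest element of
  the class is minimal, and minimal elements avoid 231 and therefore coincide.\<close>

lemma pi_down_avoids_231:
  assumes n: "n \<ge> 1" and w: "w \<in> affine_sym n"
  shows "affine_syl n (pi_down n w) w \<and> avoids_231 (pi_down n w)"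
proof -
  let ?P = "\<lambda>u. affine_syl n u w \<and> (\<forall>x. affine_syl n x w \<and> left_weak_le n x u \<longrightarrow> x = u)"
  have av: "avoids_231 u" if "?P u" for u
  proof (rule minimal_imp_avoids_231[OF n])
    show "u \<in> affine_sym n" using that by (simp add: affine_syl_def)
    show "x = u" if "affine_syl n x u" "left_weak_le n x u" for x
      using \<open>?P u\<close> that by (auto simp: affine_syl_def)
  qed
  have "affine_syl n w w" using w by (simp add: affine_syl_def)
  then obtain u where u: "affine_syl n u w"
    and least: "\<And>x. affine_syl n x w \<Longrightarrow> cox_length n u \<le> cox_length n x"
    using ex_has_least_nat[of "\<lambda>u. affine_syl n u w" w "cox_length n"] by blast
  have "?P u"
  proof (intro conjI allI impI u, elim conjE)
    fix x assume x: "affine_syl n x w" "left_weak_le n x u"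
    have ux: "u \<in> affine_sym n" "x \<in> affine_sym n" using u x by (auto simp: affine_syl_def)
    have "cox_length n (u \<circ> inv x) = 0" using x(2) least[OF x(1)] by (simp add: left_weak_le_def)
    then have "u \<circ> inv x = id"
      using cox_length_eq_0_imp_id[OF n affine_comp[OF ux(1) affine_inv[OF ux(2)]]] by blast
    then have "(u \<circ> inv x) (x i) = x i" for i by simp
    then show "x = u" using affine_symD(1)[OF ux(2)] by (auto simp: fun_eq_iff bij_is_inj)
  qed
  moreover have "x = u" if "?P x" for x
    using avoids_231_unique[OF n _ av[OF that] av[OF \<open>?P u\<close>]] that u by (auto simp: affine_syl_def)
  ultimately have "?P (pi_down n w)" unfolding pi_down_def by (rule theI)
  then show ?thesis using av by blast
qed

lemma pi_down_cong:
  assumes "affine_syl n v w"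
  shows "pi_down n v = pi_down n w"
  using assms by (simp add: pi_down_def affine_syl_def)

section \<open>Stack-sorting trees\<close>

lemma affine_syl_sym: "affine_syl n v w \<Longrightarrow> affine_syl n w v"
  by (simp add: affine_syl_def)

lemma stack_sort_affine:
  assumes "n \<ge> 1" and "u \<in> affine_sym n"
  shows "stack_sort n u \<in> affine_sym n"
  using pi_down_avoids_231[OF assms] assms(2)
  by (auto simp: stack_sort_def affine_syl_def intro: affine_comp affine_inv)

text \<open>In \<open>u = stack_sort n u \<circ> p\<close> with \<open>p = pi_down n u\<close>,
  \<open>desc_le_comp_eq\<close> replaces the left factor without leaving the class of
  \<open>p\<close>; hence \<open>g \<circ> u\<close> has the same minimal element.\<close>

lemma stack_sort_lift:
  assumes n: "n \<ge> 1" and u: "u \<in> affine_sym n" and g: "g \<in> affine_sym n"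
    and syl: "affine_syl n (stack_sort n u) (g \<circ> stack_sort n u)"
  shows "affine_syl n u (g \<circ> u)" and "stack_sort n (g \<circ> u) = g \<circ> stack_sort n u"
proof -
  define p where "p = pi_down n u"
  define u' where "u' = stack_sort n u"
  have p: "affine_syl n p u" "avoids_231 p"
    using pi_down_avoids_231[OF n u] by (auto simp: p_def)
  then have p_bij: "bij p" using affine_symD(1) by (auto simp: affine_syl_def)
  have u_eq: "u = u' \<circ> p"
    using p_bij by (simp add: u'_def stack_sort_def p_def[symmetric] comp_assoc bij_is_inj)
  have gu: "g \<circ> u \<in> affine_sym n" using affine_comp[OF g u] .
  have "desc_le ((g \<circ> u') \<circ> p) = desc_le p"
  proof (rule desc_le_comp_eq[OF p_bij _ p(2)])
    show "desc_le (u' \<circ> p) = desc_le p" using p(1) by (simp add: affine_syl_def flip: u_eq)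
    show "desc_le u' = desc_le (g \<circ> u')" using syl by (simp add: affine_syl_def u'_def)
    show "inj (g \<circ> u')" using syl affine_symD(1) bij_is_inj unfolding affine_syl_def u'_def by blast
  qed
  then have "desc_le (g \<circ> u) = desc_le u"
    using p(1) by (simp add: affine_syl_def u_eq comp_assoc)
  then show *: "affine_syl n u (g \<circ> u)" using u gu by (simp add: affine_syl_def)
  show "stack_sort n (g \<circ> u) = g \<circ> stack_sort n u"
    using pi_down_cong[OF *] by (simp add: stack_sort_def comp_assoc)
qed

text \<open>The congruence climbs from \<open>v\<close>: once known for
  \<open>stack_sort n u\<close>, it follows for \<open>u\<close> by
  \<open>stack_sort_lift\<close>.\<close>

lemma stack_sort_iterate_lift:
  assumes n: "n \<ge> 1" and g: "g \<in> affine_sym n" and syl: "affine_syl n v (g \<circ> v)"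
    and "u \<in> affine_sym n" and "(stack_sort n ^^ t) u = v"
  shows "affine_syl n u (g \<circ> u) \<and> (stack_sort n ^^ t) (g \<circ> u) = g \<circ> v"
  using assms(4,5)
proof (induction t arbitrary: u)
  case 0
  then have "u = v" by simp
  then show ?case using syl by (simp only: funpow.simps id_apply)
next
  case (Suc t)
  have step: "(stack_sort n ^^ Suc t) x = (stack_sort n ^^ t) (stack_sort n x)" for x
    by (simp only: funpow_Suc_right comp_apply)
  have "(stack_sort n ^^ t) (stack_sort n u) = v" using Suc.prems(2) step by simp
  then have IH: "affine_syl n (stack_sort n u) (g \<circ> stack_sort n u)"
    "(stack_sort n ^^ t) (g \<circ> stack_sort n u) = g \<circ> v"
    using Suc.IH[OF stack_sort_affine[OF n Suc.prems(1)]] by blast+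
  show ?case
    using stack_sort_lift[OF n Suc.prems(1) g IH(1)] IH(2) unfolding step by metis
qed

section \<open>Descendant sets and edges of the subtrees\<close>

definition stack_sort_descendants :: "nat \<Rightarrow> (int \<Rightarrow> int) \<Rightarrow> (int \<Rightarrow> int) set" where
  "stack_sort_descendants n x = (\<Union>t. {u \<in> affine_sym n. (stack_sort n ^^ t) u = x})"

lemma stack_sort_subtree_simps:
  "verts (stack_sort_subtree n x) = stack_sort_descendants n x"
  "edges (stack_sort_subtree n x) =
    {e \<in> edges (stack_sort_tree n). e \<subseteq> stack_sort_descendants n x}"
  "root (stack_sort_subtree n x) = x"
  by (simp_all add: stack_sort_subtree_def stack_sort_descendants_def Let_def)

lemma stack_sort_tree_edge_iff:
  assumes "x \<in> affine_sym n" "y \<in> affine_sym n"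
  shows "{x, y} \<in> edges (stack_sort_tree n) \<longleftrightarrow>
    x \<noteq> id \<and> y = stack_sort n x \<or> y \<noteq> id \<and> x = stack_sort n y"
  using assms by (auto simp: stack_sort_tree_def doubleton_eq_iff)

lemma descendants_lift:
  assumes n: "n \<ge> 1" and g: "g \<in> affine_sym n" and syl: "affine_syl n v (g \<circ> v)"
    and x: "x \<in> stack_sort_descendants n v"
  shows "x \<in> affine_sym n" "affine_syl n x (g \<circ> x)" "g \<circ> x \<in> stack_sort_descendants n (g \<circ> v)"
proof -
  obtain t where t: "x \<in> affine_sym n" "(stack_sort n ^^ t) x = v"
    using x by (auto simp: stack_sort_descendants_def)
  note lift = stack_sort_iterate_lift[OF n g syl t]
  show "x \<in> affine_sym n" "affine_syl n x (g \<circ> x)" using t lift by auto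
  then show "g \<circ> x \<in> stack_sort_descendants n (g \<circ> v)"
    using lift by (auto simp: stack_sort_descendants_def affine_syl_def)
qed

text \<open>The class of \<open>id\<close> is a singleton and \<open>g \<circ> x\<close> is
  congruent to \<open>x\<close>, so a vertex that has a parent edge keeps one.\<close>

lemma descendants_edge_lift:
  assumes n: "n \<ge> 1" and g: "g \<in> affine_sym n" and syl: "affine_syl n v (g \<circ> v)"
    and x: "x \<in> stack_sort_descendants n v" and y: "y \<in> stack_sort_descendants n v"
    and "x \<noteq> id" and "y = stack_sort n x"
  shows "g \<circ> x \<noteq> id \<and> g \<circ> y = stack_sort n (g \<circ> x)"
proof
  show "g \<circ> x \<noteq> id"
    using descendants_lift(2)[OF n g syl x] affine_syl_id[OF n, of x] \<open>x \<noteq> id\<close> by auto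
  show "g \<circ> y = stack_sort n (g \<circ> x)"
    using stack_sort_lift(2)[OF n descendants_lift(1)[OF n g syl x] g]
      descendants_lift(2)[OF n g syl y] \<open>y = stack_sort n x\<close> by simp
qed

theorem theorem8p4:
  fixes n :: nat and v w :: "int \<Rightarrow> int"
  assumes "n \<ge> 1"
    and "v \<in> affine_sym n" and "w \<in> affine_sym n"
    and "affine_syl n v w"
  shows "rooted_tree_iso (stack_sort_subtree n v) (stack_sort_subtree n w) \<and>
    fertility n v = fertility n w"
proof -
  note n = assms(1)
  define g where "g = w \<circ> inv v"
  \<comment> \<open>\<open>h\<close> is the inverse of \<open>g\<close>; the lifting lemmas are used
    for both, with \<open>v\<close> and \<open>w\<close> exchanged.\<close>
  define h where "h = v \<circ> inv w"
  have bij: "bij v" "bij w" using affine_symD(1) assms(2,3) by auto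
  have g: "g \<in> affine_sym n" and h: "h \<in> affine_sym n"
    using assms affine_comp affine_inv by (auto simp: g_def h_def)
  have gv: "g \<circ> v = w" and hw: "h \<circ> w = v"
    using bij by (simp_all add: g_def h_def comp_assoc bij_is_inj)
  have hg: "h \<circ> (g \<circ> x) = x" and gh: "g \<circ> (h \<circ> x) = x" for x
    using bij by (auto simp: g_def h_def fun_eq_iff bij_is_inj bij_is_surj surj_f_inv_f)
  have sylg: "affine_syl n v (g \<circ> v)" using assms(4) gv by simp
  have sylh: "affine_syl n w (h \<circ> w)" using affine_syl_sym[OF assms(4)] hw by simp
  note lift = descendants_lift[OF n g sylg, unfolded gv]
    and lift' = descendants_lift[OF n h sylh, unfolded hw]
  note edge = descendants_edge_lift[OF n g sylg]
    and edge' = descendants_edge_lift[OF n h sylh]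
  let ?V = "stack_sort_descendants n v" and ?W = "stack_sort_descendants n w"
  have "bij_betw ((\<circ>) g) ?V ?W"
    using lift(3) lift'(3) hg gh by (intro bij_betw_byWitness[where f' = "(\<circ>) h"]) auto
  moreover have "{x, y} \<in> edges (stack_sort_subtree n v) \<longleftrightarrow>
      {g \<circ> x, g \<circ> y} \<in> edges (stack_sort_subtree n w)" if "x \<in> ?V" "y \<in> ?V" for x y
  proof -
    have W: "g \<circ> x \<in> ?W" "g \<circ> y \<in> ?W" using that lift(3) by auto
    \<comment> \<open>The converse is the edge lift by \<open>h\<close> at
      \<open>g \<circ> a\<close> and \<open>g \<circ> b\<close>, which \<open>h\<close> sends back
      to \<open>a\<close> and \<open>b\<close>.\<close>
    have "(a \<noteq> id \<and> b = stack_sort n a) \<longleftrightarrow>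
        (g \<circ> a \<noteq> id \<and> g \<circ> b = stack_sort n (g \<circ> a))" if "a \<in> ?V" "b \<in> ?V" for a b
      using edge[OF that] edge'[OF lift(3)[OF that(1)] lift(3)[OF that(2)]] hg by metis
    then show ?thesis
      using that W lift(1)[OF that(1)] lift(1)[OF that(2)] lift'(1)[OF W(1)] lift'(1)[OF W(2)]
      by (simp add: stack_sort_subtree_simps stack_sort_tree_edge_iff)
  qed
  ultimately have "rooted_tree_iso (stack_sort_subtree n v) (stack_sort_subtree n w)"
    unfolding rooted_tree_iso_def stack_sort_subtree_simps(1,3) using gv by blast
  moreover have "fertility n v = fertility n w"
  proof -
    \<comment> \<open>Fertility counts the preimages under one iteration, so the iterate lemma is
      used with one step.\<close>
    have "g \<circ> u \<in> {u \<in> affine_sym n. stack_sort n u = w}"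
      if "u \<in> {u \<in> affine_sym n. stack_sort n u = v}" for u
      using that stack_sort_iterate_lift[OF n g sylg, of u 1] gv by (simp add: affine_syl_def)
    moreover have "h \<circ> u \<in> {u \<in> affine_sym n. stack_sort n u = v}"
      if "u \<in> {u \<in> affine_sym n. stack_sort n u = w}" for u
      using that stack_sort_iterate_lift[OF n h sylh, of u 1] hw by (simp add: affine_syl_def)
    ultimately have "bij_betw ((\<circ>) g) {u \<in> affine_sym n. stack_sort n u = v}
        {u \<in> affine_sym n. stack_sort n u = w}"
      using hg gh by (intro bij_betw_byWitness[where f' = "(\<circ>) h"]) blast+
    then show ?thesis unfolding fertility_def by (rule bij_betw_same_card)
  qed
  ultimately show ?thesis by blast
qed

end
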